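(* Let $(\mathcal{M},\mathcal{F})$ be a complex foliation and let $f$ be a smooth function on $\mathcal{M}$. If $f$ does not vanish anywhere on $\mathcal{M}$, then $H^{\bullet,\bullet}_f(\mathcal{F})$ is isomorphic to the foliated Dolbeault cohomology $H^{\bullet,\bullet}(\mathcal{F})$, i.e. $H^{p,q}_f(\mathcal{F})\cong H^{p,q}(\mathcal{F})$ as complex vector spaces for all $p,q$.
   Context: Complex foliation: $\mathcal{M}$ is a smooth manifold of dimension $2m+n$ with a foliation $\mathcal{F}$ of codimension $n$, defined by an open cover $\{U_i\}_{i\in I}$ of $\mathcal{M}$ and diffeomorphisms $\phi_i:\Omega_i\times\mathcal{O}_i\to U_i$ ($\Omega_i$ an open polydisc in $\mathbb{C}^m$, $\mathcal{O}_i$ an open ball in $\mathbb{R}^n$) such that, whenever $U_i\cap U_j\neq\emptyset$, the coordinate change $\phi_j^{-1}\circ\phi_i$ has the form $(z',x')=(\phi_{ij}^1(z,x),\phi_{ij}^2(x))$ with $\phi_{ij}^1(z,x)$ holomorphic in $z$ for fixed $x$. The leaves, locally given by $x=$ const, are complex manifolds of dimension $m$. The coordinates $(z,x)=(z^1,\ldots,z^m,x^1,\ldots,x^n)$ on $U_i$ given by $\phi_i^{-1}:U_i\to\Omega_i\times\mathcal{O}_i$ are called adapted. Foliated forms: $\Omega^{p,q}(\mathcal{F})$ is the space of foliated (leafwise) differential forms of type $(p,q)$, written in adapted coordinates as $\varphi=\sum\varphi_{A_p\overline{B}_q}(z,x)\,dz^{A_p}\wedge d\overline{z}^{B_q}$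 with smooth complex-valued coefficients, where $dz^a,d\overline{z}^a$ are regarded as forms along the leaves (sections of the exterior algebra of the dual of $T\mathcal{F}\otimes\mathbb{C}$). It is $0$ unless $0\le p,q\le m$. The operator $\overline{\partial}_{\mathcal{F}}:\Omega^{p,q}(\mathcal{F})\to\Omega^{p,q+1}(\mathcal{F})$ is $\overline{\partial}_{\mathcal{F}}\varphi=\sum_{a=1}^m\sum\frac{\partial\varphi_{A_p\overline{B}_q}}{\partial\overline{z}^a}\,d\overline{z}^a\wedge dz^{A_p}\wedge d\overline{z}^{B_q}$, with $\overline{\partial}_{\mathcal{F}}^2=0$. For fixed $p$, the foliated Dolbeault cohomology $H^{p,q}(\mathcal{F})$ is the degree-$q$ cohomology of the complex $0\to\Omega^{p,0}(\mathcal{F})\to\Omega^{p,1}(\mathcal{F})\to\cdots\to\Omega^{p,m}(\mathcal{F})\to0$ with differential $\overline{\partial}_{\mathcal{F}}$. Smooth functions on $\mathcal{M}$ may be taken complex-valued. For a smooth function $f$ on $\mathcal{M}$, define $\overline{\partial}_{\mathcal{F},f}:\Omega^{p,q}(\mathcal{F})\to\Omega^{p,q+1}(\mathcal{F})$ by $\overline{\partial}_{\mathcal{F},f}\varphi=f\,\overline{\partial}_{\mathcal{F}}\varphi-(p+q)\,\overline{\partial}_{\mathcal{F}}f\wedge\varphi$. It satisfies $\overline{\partial}_{\mathcal{F},f}^2=0$, and $H^{p,q}_f(\mathcal{F})$ denotes the degree-$q$ cohomology of the same sequence of spaces with differential $\overline{\partial}_{\mathcal{F},f}$. *)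

theory Defs
  imports "HOL-Analysis.Analysis" "HOL-Library.Function_Algebras"
begin

text \<open>
  The space R^d is the library's \<open>Euclidean_space d\<close>, a topology on the functions
  \<open>nat \<Rightarrow> real\<close> vanishing from index \<open>d\<close> on. This allows every dimension, including 0,
  and dimensions that are sums of other dimensions.
\<close>


section \<open>Smooth maps on open subsets of R^d\<close>

definition partial :: "nat \<Rightarrow> ((nat \<Rightarrow> real) \<Rightarrow> 'b::real_normed_vector) \<Rightarrow> (nat \<Rightarrow> real) \<Rightarrow> 'b"
  where "partial i g y = vector_derivative (\<lambda>t. g (y(i := t))) (at (y i))"

text \<open>
  Continuous, with all iterated partial derivatives up to order \<open>k\<close> existing and continuous.
  Only meant for \<open>W\<close> open in R^d; the values of \<open>g\<close> off \<open>W\<close> are then irrelevant.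
\<close>

primrec Ck_on :: "nat \<Rightarrow> nat \<Rightarrow> (nat \<Rightarrow> real) set
    \<Rightarrow> ((nat \<Rightarrow> real) \<Rightarrow> 'b::real_normed_vector) \<Rightarrow> bool"
  where
    "Ck_on 0 d W g \<longleftrightarrow> continuous_on W g"
  | "Ck_on (Suc k) d W g \<longleftrightarrow> continuous_on W g \<and>
      (\<forall>i<d. (\<forall>y\<in>W. (\<lambda>t. g (y(i := t))) differentiable (at (y i))) \<and> Ck_on k d W (partial i g))"

definition smooth_on :: "nat \<Rightarrow> (nat \<Rightarrow> real) set
    \<Rightarrow> ((nat \<Rightarrow> real) \<Rightarrow> 'b::real_normed_vector) \<Rightarrow> bool"
  where "smooth_on d W g \<longleftrightarrow> (\<forall>k. Ck_on k d W g)"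

definition smooth_map_on :: "nat \<Rightarrow> (nat \<Rightarrow> real) set \<Rightarrow> ((nat \<Rightarrow> real) \<Rightarrow> nat \<Rightarrow> real) \<Rightarrow> bool"
  where "smooth_map_on d W g \<longleftrightarrow> (\<forall>j<d. smooth_on d W (\<lambda>y. g y j))"


section \<open>Smooth manifolds\<close>

text \<open>A chart is a pair of an open set \<open>V\<close> and a map \<open>\<kappa>\<close> of which only the values on \<open>V\<close> matter.\<close>

definition chart :: "nat \<Rightarrow> 'a topology \<Rightarrow> 'a set \<times> ('a \<Rightarrow> nat \<Rightarrow> real) \<Rightarrow> bool"
  where "chart d M = (\<lambda>(V, \<kappa>). openin M V \<and> openin (Euclidean_space d) (\<kappa> ` V) \<and>
    homeomorphic_map (subtopology M V) (subtopology (Euclidean_space d) (\<kappa> ` V)) \<kappa>)"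

definition compatible :: "nat \<Rightarrow> 'a set \<times> ('a \<Rightarrow> nat \<Rightarrow> real) \<Rightarrow> 'a set \<times> ('a \<Rightarrow> nat \<Rightarrow> real) \<Rightarrow> bool"
  where "compatible d = (\<lambda>(V, \<kappa>) (V', \<kappa>').
    smooth_map_on d (\<kappa> ` (V \<inter> V')) (\<kappa>' \<circ> inv_into V \<kappa>) \<and>
    smooth_map_on d (\<kappa>' ` (V \<inter> V')) (\<kappa> \<circ> inv_into V' \<kappa>'))"

text \<open>The smooth structure is given as a maximal smooth atlas.\<close>

definition smooth_manifold :: "nat \<Rightarrow> 'a topology \<Rightarrow> ('a set \<times> ('a \<Rightarrow> nat \<Rightarrow> real)) set \<Rightarrow> bool"
  where "smooth_manifold d M \<A> \<longleftrightarrow>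
    Hausdorff_space M \<and> second_countable M \<and>
    (\<forall>c\<in>\<A>. chart d M c) \<and>
    (\<Union>c\<in>\<A>. fst c) = topspace M \<and>
    (\<forall>c\<in>\<A>. \<forall>c'\<in>\<A>. compatible d c c') \<and>
    (\<forall>c. chart d M c \<and> (\<forall>c'\<in>\<A>. compatible d c c') \<longrightarrow> c \<in> \<A>)"

definition smooth_function :: "nat \<Rightarrow> ('a set \<times> ('a \<Rightarrow> nat \<Rightarrow> real)) set \<Rightarrow> ('a \<Rightarrow> complex) \<Rightarrow> bool"
  where "smooth_function d \<A> f \<longleftrightarrow> (\<forall>(V, \<kappa>)\<in>\<A>. smooth_on d (\<kappa> ` V) (f \<circ> inv_into V \<kappa>))"

text \<open>Diffeomorphisms from an open subset \<open>W\<close> of R^d onto an open subset \<open>U\<close> of the manifold.\<close>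

definition diffeomorphism :: "nat \<Rightarrow> 'a topology \<Rightarrow> ('a set \<times> ('a \<Rightarrow> nat \<Rightarrow> real)) set
    \<Rightarrow> (nat \<Rightarrow> real) set \<Rightarrow> 'a set \<Rightarrow> ((nat \<Rightarrow> real) \<Rightarrow> 'a) \<Rightarrow> bool"
  where "diffeomorphism d M \<A> W U \<phi> \<longleftrightarrow>
    homeomorphic_map (subtopology (Euclidean_space d) W) (subtopology M U) \<phi> \<and>
    (\<forall>(V, \<kappa>)\<in>\<A>.
      smooth_map_on d {y\<in>W. \<phi> y \<in> V} (\<kappa> \<circ> \<phi>) \<and>
      smooth_map_on d (\<kappa> ` (U \<inter> V)) (inv_into W \<phi> \<circ> inv_into V \<kappa>))"


section \<open>Complex foliations\<close>

text \<open>
  C^m x R^n is identified with R^(2m+n): the coordinate \<open>z\<^sup>a\<close> (for \<open>a < m\<close>) has real and imaginary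
  part at the positions \<open>2a\<close> and \<open>2a+1\<close>, and \<open>x\<^sup>b\<close> (for \<open>b < n\<close>) is at position \<open>2m+b\<close>.
\<close>

definition zcoord :: "nat \<Rightarrow> (nat \<Rightarrow> real) \<Rightarrow> complex"
  where "zcoord a y = Complex (y (2*a)) (y (2*a+1))"

definition xcoord :: "nat \<Rightarrow> nat \<Rightarrow> (nat \<Rightarrow> real) \<Rightarrow> real"
  where "xcoord m b y = y (2*m + b)"

definition set_zcoord :: "nat \<Rightarrow> complex \<Rightarrow> (nat \<Rightarrow> real) \<Rightarrow> (nat \<Rightarrow> real)"
  where "set_zcoord a w y = y(2*a := Re w, 2*a+1 := Im w)"

text \<open>The products of an open polydisc in C^m and an open ball in R^n.\<close>

definition polydisc_times_ball :: "nat \<Rightarrow> nat \<Rightarrow> (nat \<Rightarrow> real) set \<Rightarrow> bool"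
  where "polydisc_times_ball m n W \<longleftrightarrow>
    (\<exists>(c :: nat \<Rightarrow> complex) (r :: nat \<Rightarrow> real) (x\<^sub>0 :: nat \<Rightarrow> real) (\<rho> :: real).
      (\<forall>a<m. r a > 0) \<and> \<rho> > 0 \<and>
      W = {y \<in> topspace (Euclidean_space (2*m+n)).
            (\<forall>a<m. zcoord a y \<in> ball (c a) (r a)) \<and>
            (\<Sum>b<n. (xcoord m b y - x\<^sub>0 b)\<^sup>2) < \<rho>\<^sup>2})"

definition overlap :: "('i \<Rightarrow> (nat \<Rightarrow> real) set) \<Rightarrow> ('i \<Rightarrow> (nat \<Rightarrow> real) \<Rightarrow> 'a)
    \<Rightarrow> 'i \<Rightarrow> 'i \<Rightarrow> (nat \<Rightarrow> real) set"
  where "overlap W \<phi> i j = {y \<in> W i. \<phi> i y \<in> \<phi> j ` W j}"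

definition transition :: "('i \<Rightarrow> (nat \<Rightarrow> real) set) \<Rightarrow> ('i \<Rightarrow> (nat \<Rightarrow> real) \<Rightarrow> 'a)
    \<Rightarrow> 'i \<Rightarrow> 'i \<Rightarrow> (nat \<Rightarrow> real) \<Rightarrow> (nat \<Rightarrow> real)"
  where "transition W \<phi> i j = inv_into (W j) (\<phi> j) \<circ> \<phi> i"

text \<open>
  Holomorphy in \<open>z\<close> of the (smooth) coordinate changes is holomorphy in each of the variables
  \<open>z\<^sup>b\<close> separately, the other coordinates being kept fixed.
\<close>

definition complex_foliation :: "nat \<Rightarrow> nat \<Rightarrow> 'a topology \<Rightarrow> ('a set \<times> ('a \<Rightarrow> nat \<Rightarrow> real)) set
    \<Rightarrow> 'i set \<Rightarrow> ('i \<Rightarrow> (nat \<Rightarrow> real) set) \<Rightarrow> ('i \<Rightarrow> 'a set) \<Rightarrow> ('i \<Rightarrow> (nat \<Rightarrow> real) \<Rightarrow> 'a) \<Rightarrow> bool"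
  where "complex_foliation m n M \<A> I W U \<phi> \<longleftrightarrow>
    smooth_manifold (2*m+n) M \<A> \<and>
    (\<forall>i\<in>I. openin M (U i)) \<and> (\<Union>i\<in>I. U i) = topspace M \<and>
    (\<forall>i\<in>I. polydisc_times_ball m n (W i)) \<and>
    (\<forall>i\<in>I. diffeomorphism (2*m+n) M \<A> (W i) (U i) (\<phi> i)) \<and>
    (\<forall>i\<in>I. \<forall>j\<in>I.
      (\<forall>y\<in>overlap W \<phi> i j. \<forall>y'\<in>overlap W \<phi> i j.
        (\<forall>b<n. xcoord m b y = xcoord m b y') \<longrightarrow>
        (\<forall>b<n. xcoord m b (transition W \<phi> i j y) = xcoord m b (transition W \<phi> i j y'))) \<and>
      (\<forall>y\<in>overlap W \<phi> i j. \<forall>a<m. \<forall>b<m.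
        (\<lambda>w. zcoord a (transition W \<phi> i j (set_zcoord b w y)))
          holomorphic_on {w. set_zcoord b w y \<in> overlap W \<phi> i j}))"


section \<open>The exterior algebra on the generators dz and its conjugates\<close>

text \<open>
  An element of the exterior algebra on \<open>e\<^sub>0, e\<^sub>1, \<dots>\<close> is given by its coefficients with
  respect to the basis of the \<open>e\<^sub>S = e\<^bsub>s\<^esub> \<and> \<dots> \<and> e\<^bsub>t\<^esub>\<close> for finite \<open>S = {s < \<dots> < t}\<close>.
  Here \<open>e\<^sub>a\<close> is \<open>dz\<^sup>a\<close> and \<open>e\<^bsub>m+a\<^esub>\<close> is the conjugate of \<open>dz\<^sup>a\<close>, for \<open>a < m\<close>; so \<open>e\<^sub>S\<close> is a product of
  \<open>dz\<^sup>a\<close>'s followed by a product of conjugates.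
\<close>

type_synonym ext = "nat set \<Rightarrow> complex"

definition ext_scale :: "complex \<Rightarrow> ext \<Rightarrow> ext"
  where "ext_scale c \<alpha> = (\<lambda>S. c * \<alpha> S)"

definition ext_one :: ext
  where "ext_one = (\<lambda>S. if S = {} then 1 else 0)"

definition ext_gen :: "nat \<Rightarrow> ext"
  where "ext_gen s = (\<lambda>S. if S = {s} then 1 else 0)"

text \<open>
  For disjoint \<open>T\<close> and \<open>T'\<close>, the product of \<open>e\<^sub>T\<close> and \<open>e\<^bsub>T'\<^esub>\<close> is \<open>e\<^bsub>T \<union> T'\<^esub>\<close> up to the sign of the
  sorting permutation; it is 0 if they meet.
\<close>

definition wedge :: "ext \<Rightarrow> ext \<Rightarrow> ext"
  where "wedge \<alpha> \<beta> = (\<lambda>S. \<Sum>T\<in>Pow S.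
    (-1) ^ card {(t, u). t \<in> T \<and> u \<in> S - T \<and> u < t} * \<alpha> T * \<beta> (S - T))"

definition dz :: "nat \<Rightarrow> ext"
  where "dz a = ext_gen a"

definition dzbar :: "nat \<Rightarrow> nat \<Rightarrow> ext"
  where "dzbar m a = ext_gen (m + a)"

definition has_type :: "nat \<Rightarrow> nat \<Rightarrow> nat \<Rightarrow> ext \<Rightarrow> bool"
  where "has_type m p q \<alpha> \<longleftrightarrow> (\<forall>S. \<alpha> S \<noteq> 0 \<longrightarrow>
    S \<subseteq> {..<2*m} \<and> card (S \<inter> {..<m}) = p \<and> card (S \<inter> {m..<2*m}) = q)"


section \<open>Foliated forms\<close>

definition partial_z :: "nat \<Rightarrow> ((nat \<Rightarrow> real) \<Rightarrow> complex) \<Rightarrow> (nat \<Rightarrow> real) \<Rightarrow> complex"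
  where "partial_z a g y = (partial (2*a) g y - \<i> * partial (2*a+1) g y) / 2"

definition partial_zbar :: "nat \<Rightarrow> ((nat \<Rightarrow> real) \<Rightarrow> complex) \<Rightarrow> (nat \<Rightarrow> real) \<Rightarrow> complex"
  where "partial_zbar a g y = (partial (2*a) g y + \<i> * partial (2*a+1) g y) / 2"

text \<open>The exterior derivative of a function along the leaves.\<close>

definition leafwise_d :: "nat \<Rightarrow> ((nat \<Rightarrow> real) \<Rightarrow> complex) \<Rightarrow> (nat \<Rightarrow> real) \<Rightarrow> ext"
  where "leafwise_d m g y =
    (\<Sum>a<m. ext_scale (partial_z a g y) (dz a) + ext_scale (partial_zbar a g y) (dzbar m a))"

text \<open>The function whose leafwise derivative is \<open>e\<^sub>s\<close>.\<close>

definition leaf_coord :: "nat \<Rightarrow> nat \<Rightarrow> (nat \<Rightarrow> real) \<Rightarrow> complex"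
  where "leaf_coord m s y = (if s < m then zcoord s y else cnj (zcoord (s - m) y))"

text \<open>
  The pullback of \<open>\<alpha>\<close>, an exterior form along the leaves at the point \<open>\<tau> y\<close>, to the point \<open>y\<close>:
  the algebra homomorphism that sends \<open>e\<^sub>s\<close> to the leafwise derivative of the \<open>s\<close>-th coordinate of \<open>\<tau>\<close>.
\<close>

definition pullback :: "nat \<Rightarrow> ((nat \<Rightarrow> real) \<Rightarrow> (nat \<Rightarrow> real)) \<Rightarrow> (nat \<Rightarrow> real) \<Rightarrow> ext \<Rightarrow> ext"
  where "pullback m \<tau> y \<alpha> = (\<Sum>T\<in>Pow {..<2*m}. ext_scale (\<alpha> T)
    (foldr wedge (map (\<lambda>s. leafwise_d m (leaf_coord m s \<circ> \<tau>) y) (sorted_list_of_set T)) ext_one))"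

text \<open>
  A foliated form is given by its expressions in the adapted coordinate systems, which
  correspond to each other under the coordinate changes. The expression in the \<open>i\<close>-th system is a
  function on \<open>W i\<close>; to have a vector space with pointwise operations it is extended by 0.
\<close>

type_synonym 'i form = "'i \<Rightarrow> (nat \<Rightarrow> real) \<Rightarrow> ext"

definition foliated_forms :: "nat \<Rightarrow> nat \<Rightarrow> 'i set \<Rightarrow> ('i \<Rightarrow> (nat \<Rightarrow> real) set)
    \<Rightarrow> ('i \<Rightarrow> (nat \<Rightarrow> real) \<Rightarrow> 'a) \<Rightarrow> nat \<Rightarrow> nat \<Rightarrow> 'i form set"
  where "foliated_forms m n I W \<phi> p q = {\<omega>.
    (\<forall>i y. \<not> (i \<in> I \<and> y \<in> W i) \<longrightarrow> \<omega> i y = 0) \<and>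
    (\<forall>i\<in>I. \<forall>y\<in>W i. has_type m p q (\<omega> i y)) \<and>
    (\<forall>i\<in>I. \<forall>S. smooth_on (2*m+n) (W i) (\<lambda>y. \<omega> i y S)) \<and>
    (\<forall>i\<in>I. \<forall>j\<in>I. \<forall>y\<in>overlap W \<phi> i j.
      \<omega> i y = pullback m (transition W \<phi> i j) y (\<omega> j (transition W \<phi> i j y)))}"

definition delbar :: "nat \<Rightarrow> 'i set \<Rightarrow> ('i \<Rightarrow> (nat \<Rightarrow> real) set) \<Rightarrow> 'i form \<Rightarrow> 'i form"
  where "delbar m I W \<omega> = (\<lambda>i y. if i \<in> I \<and> y \<in> W i
    then \<Sum>a<m. wedge (dzbar m a) (\<lambda>S. partial_zbar a (\<lambda>y'. \<omega> i y' S) y) else 0)"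

definition form_scale :: "complex \<Rightarrow> 'i form \<Rightarrow> 'i form"
  where "form_scale c \<omega> = (\<lambda>i y. ext_scale c (\<omega> i y))"

definition form_mult :: "('i \<Rightarrow> (nat \<Rightarrow> real) \<Rightarrow> 'a) \<Rightarrow> ('a \<Rightarrow> complex) \<Rightarrow> 'i form \<Rightarrow> 'i form"
  where "form_mult \<phi> f \<omega> = (\<lambda>i y. ext_scale (f (\<phi> i y)) (\<omega> i y))"

definition form_wedge :: "'i form \<Rightarrow> 'i form \<Rightarrow> 'i form"
  where "form_wedge \<omega> \<eta> = (\<lambda>i y. wedge (\<omega> i y) (\<eta> i y))"

definition form_of_function :: "'i set \<Rightarrow> ('i \<Rightarrow> (nat \<Rightarrow> real) set)
    \<Rightarrow> ('i \<Rightarrow> (nat \<Rightarrow> real) \<Rightarrow> 'a) \<Rightarrow> ('a \<Rightarrow> complex) \<Rightarrow> 'i form"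
  where "form_of_function I W \<phi> f =
    (\<lambda>i y. if i \<in> I \<and> y \<in> W i then ext_scale (f (\<phi> i y)) ext_one else 0)"

definition twisted_delbar :: "nat \<Rightarrow> 'i set \<Rightarrow> ('i \<Rightarrow> (nat \<Rightarrow> real) set)
    \<Rightarrow> ('i \<Rightarrow> (nat \<Rightarrow> real) \<Rightarrow> 'a) \<Rightarrow> ('a \<Rightarrow> complex) \<Rightarrow> nat \<Rightarrow> nat \<Rightarrow> 'i form \<Rightarrow> 'i form"
  where "twisted_delbar m I W \<phi> f p q \<omega> =
    form_mult \<phi> f (delbar m I W \<omega>)
    - form_scale (of_nat (p + q))
        (form_wedge (delbar m I W (form_of_function I W \<phi> f)) \<omega>)"


section \<open>Cohomology\<close>

record 'v complex_space =
  vectors :: "'v set"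
  vadd :: "'v \<Rightarrow> 'v \<Rightarrow> 'v"
  vscale :: "complex \<Rightarrow> 'v \<Rightarrow> 'v"

definition linear_iso :: "'v complex_space \<Rightarrow> 'w complex_space \<Rightarrow> ('v \<Rightarrow> 'w) \<Rightarrow> bool"
  where "linear_iso X Y h \<longleftrightarrow> bij_betw h (vectors X) (vectors Y) \<and>
    (\<forall>u\<in>vectors X. \<forall>v\<in>vectors X. h (vadd X u v) = vadd Y (h u) (h v)) \<and>
    (\<forall>c. \<forall>u\<in>vectors X. h (vscale X c u) = vscale Y c (h u))"

definition isomorphic_spaces :: "'v complex_space \<Rightarrow> 'w complex_space \<Rightarrow> bool"  (infix \<open>\<cong>\<^sub>C\<close> 50)
  where "X \<cong>\<^sub>C Y \<longleftrightarrow> (\<exists>h. linear_iso X Y h)"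

definition cocycles :: "(nat \<Rightarrow> 'i form set) \<Rightarrow> (nat \<Rightarrow> 'i form \<Rightarrow> 'i form) \<Rightarrow> nat \<Rightarrow> 'i form set"
  where "cocycles \<Omega> D q = {\<omega> \<in> \<Omega> q. D q \<omega> = 0}"

definition coboundaries :: "(nat \<Rightarrow> 'i form set) \<Rightarrow> (nat \<Rightarrow> 'i form \<Rightarrow> 'i form) \<Rightarrow> nat \<Rightarrow> 'i form set"
  where "coboundaries \<Omega> D q = (case q of 0 \<Rightarrow> {0} | Suc k \<Rightarrow> D k ` \<Omega> k)"

text \<open>
  The quotient of the cocycles by the coboundaries. The sum of two cosets is their sum as
  sets; adding the coboundaries in the multiple by \<open>c\<close> makes it right also for \<open>c = 0\<close>.
\<close>

definition cohomology :: "(nat \<Rightarrow> 'i form set) \<Rightarrow> (nat \<Rightarrow> 'i form \<Rightarrow> 'i form) \<Rightarrow> nat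
    \<Rightarrow> 'i form set complex_space"
  where "cohomology \<Omega> D q =
    \<lparr> vectors = (\<lambda>\<omega>. \<omega> +o coboundaries \<Omega> D q) ` cocycles \<Omega> D q,
      vadd = (\<lambda>X Y. X + Y),
      vscale = (\<lambda>c X. form_scale c ` X + coboundaries \<Omega> D q) \<rparr>"

definition dolbeault_cohomology :: "nat \<Rightarrow> nat \<Rightarrow> 'i set \<Rightarrow> ('i \<Rightarrow> (nat \<Rightarrow> real) set)
    \<Rightarrow> ('i \<Rightarrow> (nat \<Rightarrow> real) \<Rightarrow> 'a) \<Rightarrow> nat \<Rightarrow> nat \<Rightarrow> 'i form set complex_space"
  where "dolbeault_cohomology m n I W \<phi> p q =
    cohomology (foliated_forms m n I W \<phi> p) (\<lambda>_. delbar m I W) q"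

definition twisted_dolbeault_cohomology :: "nat \<Rightarrow> nat \<Rightarrow> 'i set \<Rightarrow> ('i \<Rightarrow> (nat \<Rightarrow> real) set)
    \<Rightarrow> ('i \<Rightarrow> (nat \<Rightarrow> real) \<Rightarrow> 'a) \<Rightarrow> ('a \<Rightarrow> complex) \<Rightarrow> nat \<Rightarrow> nat \<Rightarrow> 'i form set complex_space"
  where "twisted_dolbeault_cohomology m n I W \<phi> f p q =
    cohomology (foliated_forms m n I W \<phi> p) (twisted_delbar m I W \<phi> f p) q"

end

theory Submission
  imports Defs
begin

text \<open>
  Multiplication by \<open>f\<^bsup>-(p+q)\<^esup>\<close> is an isomorphism from the twisted complex to the foliated
  Dolbeault complex. It is invertible on \<open>\<Omega>\<^bsup>p,q\<^esup>\<close> because \<open>f\<close> has no zero, and with \<open>k = p + q\<close> the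
  Leibniz rule gives
  \<open>delbar (f\<^bsup>-k\<^esup> \<omega>) = f\<^bsup>-k\<^esup> delbar \<omega> - k f\<^bsup>-k-1\<^esup> delbar f \<and> \<omega>\<close>,
  which is \<open>f\<^bsup>-(k+1)\<^esup>\<close> times the twisted differential of \<open>\<omega>\<close>
  (\<open>delbar_Leibniz\<close>, \<open>delbar_inverse_power\<close>, \<open>delbar_eq_twisted_delbar\<close>). So cocycles correspond
  to cocycles and coboundaries to coboundaries (\<open>cohomology_isomorphic\<close>).

  That \<open>f\<^bsup>-k\<^esup> \<omega>\<close> is again a foliated form needs the smoothness of \<open>f\<close> in adapted coordinates,
  while \<open>f\<close> is assumed smooth in the charts of the atlas. Instead of a chain rule in several
  variables, the maximality of the atlas gives this: the inverse of an adapted parametrization is a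
  chart compatible with the atlas, so it belongs to the atlas (\<open>inverse_diffeomorphism_in_atlas\<close>).
\<close>


section \<open>Calculus of smooth functions on open subsets of R^d\<close>

text \<open>
  Partial derivatives and smoothness only see the values on the open set: a small change of one
  of the first \<open>d\<close> coordinates does not leave it.
\<close>

lemma eventually_update_in_open:
  assumes "openin (Euclidean_space d) W" "y \<in> W" "i < d"
  shows "\<forall>\<^sub>F t in nhds (y i). y(i := t) \<in> W"
proof -
  obtain O' where O': "open O'" "W = O' \<inter> {x. \<forall>j\<ge>d. x j = 0}"
    using assms(1) by (auto simp: Euclidean_space_def openin_subtopology euclidean_product_topology)
  have "continuous_on UNIV (\<lambda>t. y(i := t))"
  proof (rule continuous_on_coordinatewise_then_product)
    show "continuous_on UNIV (\<lambda>t. (y(i := t)) j)" for j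
      by (cases "j = i") auto
  qed
  then have "open ((\<lambda>t. y(i := t)) -` O')"
    using O'(1) by (simp add: continuous_on_open_vimage)
  then have "\<forall>\<^sub>F t in nhds (y i). t \<in> (\<lambda>t. y(i := t)) -` O'"
    using assms(2) O'(2) by (intro eventually_nhds_in_open) auto
  then show ?thesis
    by eventually_elim (use assms O' in auto)
qed

lemma eventually_update_eq:
  assumes "openin (Euclidean_space d) W" "y \<in> W" "i < d" "\<And>x. x \<in> W \<Longrightarrow> g x = h x"
  shows "\<forall>\<^sub>F t in nhds (y i). g (y(i := t)) = h (y(i := t))"
  using eventually_update_in_open[OF assms(1-3)] by eventually_elim (rule assms(4))

lemma partial_cong:
  assumes "openin (Euclidean_space d) W" "y \<in> W" "i < d" "\<And>x. x \<in> W \<Longrightarrow> g x = h x"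
  shows "partial i g y = partial i h y"
  unfolding partial_def
  using eventually_update_eq[where g = g and h = h, OF assms]
  by (intro vector_derivative_cong_eq) simp_all

lemma differentiable_update_cong:
  assumes "openin (Euclidean_space d) W" "y \<in> W" "i < d" "\<And>x. x \<in> W \<Longrightarrow> g x = h x"
    and "(\<lambda>t. g (y(i := t))) differentiable (at (y i))"
  shows "(\<lambda>t. h (y(i := t))) differentiable (at (y i))"
proof -
  obtain D where "((\<lambda>t. g (y(i := t))) has_derivative D) (at (y i))"
    using assms(5) by (auto simp: differentiable_def)
  moreover have "\<forall>\<^sub>F t in at (y i). g (y(i := t)) = h (y(i := t))"
    using eventually_update_eq[where g = g and h = h, OF assms(1-4)]
    by (simp add: eventually_nhds_conv_at)
  moreover have "g (y(i := y i)) = h (y(i := y i))"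
    using assms(2,4) by simp
  ultimately have "((\<lambda>t. h (y(i := t))) has_derivative D) (at (y i))"
    by (rule has_derivative_transform_eventually) simp
  then show ?thesis
    by (auto simp: differentiable_def)
qed

lemma Ck_on_cong:
  assumes "openin (Euclidean_space d) W"
  shows "(\<And>x. x \<in> W \<Longrightarrow> g x = h x) \<Longrightarrow> Ck_on k d W g \<Longrightarrow> Ck_on k d W h"
proof (induction k arbitrary: g h)
  case 0
  then show ?case by (simp cong: continuous_on_cong)
next
  case (Suc k)
  have "continuous_on W h"
    using Suc.prems by (simp cong: continuous_on_cong)
  moreover have "(\<lambda>t. h (y(i := t))) differentiable (at (y i))" if "i < d" "y \<in> W" for i y
    using differentiable_update_cong[OF assms that(2,1), of g h] Suc.prems that by simp
  moreover have "Ck_on k d W (partial i h)" if "i < d" for i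
    using Suc.IH[of "partial i g" "partial i h"] partial_cong[OF assms _ that, of _ g h]
      Suc.prems that by simp
  ultimately show ?case by simp
qed

lemma smooth_on_cong:
  assumes "openin (Euclidean_space d) W" "\<And>x. x \<in> W \<Longrightarrow> g x = h x" "smooth_on d W g"
  shows "smooth_on d W h"
  using assms(3) Ck_on_cong[where g = g and h = h, OF assms(1,2)] by (simp add: smooth_on_def)

lemma Ck_on_Suc_imp: "Ck_on (Suc k) d W g \<Longrightarrow> Ck_on k d W g"
  by (induction k arbitrary: g) auto

lemma has_vector_derivative_partial:
  assumes "(\<lambda>t. g (y(i := t))) differentiable (at (y i))"
  shows "((\<lambda>t. g (y(i := t))) has_vector_derivative partial i g y) (at (y i))"
  using assms unfolding partial_def by (rule vector_derivative_works[THEN iffD1])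

lemma Ck_on_const: "Ck_on k d W (\<lambda>y. c)"
proof (induction k arbitrary: c)
  case (Suc k)
  have "partial i (\<lambda>y. c) = (\<lambda>y. 0)" for i
    by (simp add: partial_def fun_eq_iff)
  with Suc show ?case by simp
qed simp

lemma Ck_on_add:
  assumes "openin (Euclidean_space d) W"
  shows "Ck_on k d W g \<Longrightarrow> Ck_on k d W h \<Longrightarrow> Ck_on k d W (\<lambda>y. g y + h y)"
proof (induction k arbitrary: g h)
  case 0
  then show ?case by (simp add: continuous_on_add)
next
  case (Suc k)
  have "Ck_on k d W (partial i (\<lambda>y. g y + h y))" if "i < d" for i
  proof (rule Ck_on_cong[OF assms])
    show "Ck_on k d W (\<lambda>y. partial i g y + partial i h y)"
      using Suc that by simp
    show "partial i g y + partial i h y = partial i (\<lambda>y. g y + h y) y" if "y \<in> W" for y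
      unfolding partial_def[of i "\<lambda>y. g y + h y"] using Suc.prems that \<open>i < d\<close>
      by (intro vector_derivative_at[symmetric] has_vector_derivative_add
          has_vector_derivative_partial) auto
  qed
  with Suc.prems show ?case
    by (auto intro!: continuous_on_add differentiable_add)
qed

lemma partial_mult:
  fixes g h :: "(nat \<Rightarrow> real) \<Rightarrow> 'b::real_normed_algebra"
  assumes "(\<lambda>t. g (y(i := t))) differentiable (at (y i))"
    and "(\<lambda>t. h (y(i := t))) differentiable (at (y i))"
  shows "partial i (\<lambda>y. g y * h y) y = g y * partial i h y + partial i g y * h y"
  unfolding partial_def[of i "\<lambda>y. g y * h y"]
  using has_vector_derivative_mult[OF has_vector_derivative_partial[of g y i, OF assms(1)]
      has_vector_derivative_partial[of h y i, OF assms(2)]]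
  by (intro vector_derivative_at) simp

lemma Ck_on_mult:
  fixes g h :: "(nat \<Rightarrow> real) \<Rightarrow> 'b::real_normed_algebra"
  assumes "openin (Euclidean_space d) W"
  shows "Ck_on k d W g \<Longrightarrow> Ck_on k d W h \<Longrightarrow> Ck_on k d W (\<lambda>y. g y * h y)"
proof (induction k arbitrary: g h)
  case 0
  then show ?case by (simp add: continuous_on_mult)
next
  case (Suc k)
  have "Ck_on k d W (partial i (\<lambda>y. g y * h y))" if "i < d" for i
  proof (rule Ck_on_cong[OF assms])
    show "Ck_on k d W (\<lambda>y. g y * partial i h y + partial i g y * h y)"
      using Suc.prems that
      by (intro Ck_on_add[OF assms] Suc.IH Ck_on_Suc_imp[of k _ _ g] Ck_on_Suc_imp[of k _ _ h]) auto
    show "g y * partial i h y + partial i g y * h y = partial i (\<lambda>y. g y * h y) y"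
      if "y \<in> W" for y
      using Suc.prems that \<open>i < d\<close> by (intro partial_mult[symmetric]) auto
  qed
  with Suc.prems show ?case
    by (auto intro!: continuous_on_mult differentiable_mult)
qed

lemma partial_inverse_power:
  fixes g :: "(nat \<Rightarrow> real) \<Rightarrow> complex"
  assumes "(\<lambda>t. g (y(i := t))) differentiable (at (y i))" "g y \<noteq> 0"
  shows "partial i (\<lambda>y. inverse (g y) ^ k) y
    = - (of_nat k * inverse (g y) ^ Suc k * partial i g y)"
proof -
  have "((\<lambda>w. inverse w ^ k) has_field_derivative
      - (of_nat k * inverse (g y) ^ Suc k)) (at (g (y(i := y i))))"
  proof (cases k)
    case (Suc j)
    then show ?thesis
      using DERIV_power[OF DERIV_inverse[OF assms(2)], of k] by (simp add: algebra_simps)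
  qed simp
  from field_vector_diff_chain_at[OF has_vector_derivative_partial[of g y i, OF assms(1)] this]
  show ?thesis
    unfolding partial_def[of i "\<lambda>y. inverse (g y) ^ k"]
    by (intro vector_derivative_at) (simp add: o_def mult.commute del: fun_upd_apply)
qed

text \<open>The derivative \<open>- g\<^sub>i / g\<^sup>2\<close> of \<open>1 / g\<close> contains \<open>1 / g\<close> itself, to which the induction on the
  order of differentiability applies.\<close>

lemma Ck_on_inverse:
  fixes g :: "(nat \<Rightarrow> real) \<Rightarrow> complex"
  assumes "openin (Euclidean_space d) W" "\<And>y. y \<in> W \<Longrightarrow> g y \<noteq> 0"
  shows "Ck_on k d W g \<Longrightarrow> Ck_on k d W (\<lambda>y. inverse (g y))"
proof (induction k)
  case 0
  then show ?case using assms(2) by (simp add: continuous_on_inverse)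
next
  case (Suc k)
  have "Ck_on k d W (partial i (\<lambda>y. inverse (g y)))" if "i < d" for i
  proof (rule Ck_on_cong[OF assms(1)])
    show "Ck_on k d W (\<lambda>y. - 1 * (inverse (g y) * inverse (g y) * partial i g y))"
      using Suc that Ck_on_Suc_imp[of k d W g]
      by (intro Ck_on_mult[OF assms(1)] Ck_on_const) auto
    show "- 1 * (inverse (g y) * inverse (g y) * partial i g y) = partial i (\<lambda>y. inverse (g y)) y"
      if "y \<in> W" for y
      using partial_inverse_power[of g y i 1] Suc.prems that \<open>i < d\<close> assms(2) by simp
  qed
  with Suc.prems assms(2) show ?case
    by (auto intro!: continuous_on_inverse differentiable_inverse)
qed

lemma smooth_on_mult:
  fixes g h :: "(nat \<Rightarrow> real) \<Rightarrow> 'b::real_normed_algebra"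
  assumes "openin (Euclidean_space d) W" "smooth_on d W g" "smooth_on d W h"
  shows "smooth_on d W (\<lambda>y. g y * h y)"
  using assms(2,3) by (simp add: smooth_on_def Ck_on_mult[OF assms(1)])

lemma smooth_on_power:
  fixes g :: "(nat \<Rightarrow> real) \<Rightarrow> 'b::real_normed_algebra_1"
  assumes "openin (Euclidean_space d) W" "smooth_on d W g"
  shows "smooth_on d W (\<lambda>y. g y ^ k)"
proof (induction k)
  case 0
  show ?case by (simp add: smooth_on_def Ck_on_const)
next
  case (Suc k)
  then show ?case using smooth_on_mult[OF assms(1,2)] by simp
qed

lemma smooth_on_inverse:
  fixes g :: "(nat \<Rightarrow> real) \<Rightarrow> complex"
  assumes "openin (Euclidean_space d) W" "\<And>y. y \<in> W \<Longrightarrow> g y \<noteq> 0" "smooth_on d W g"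
  shows "smooth_on d W (\<lambda>y. inverse (g y))"
  using assms(3) by (simp add: smooth_on_def Ck_on_inverse[where g = g, OF assms(1,2)])

lemma smooth_on_imp_differentiable:
  assumes "smooth_on d W g" "y \<in> W" "i < d"
  shows "(\<lambda>t. g (y(i := t))) differentiable (at (y i))"
proof -
  have "Ck_on (Suc 0) d W g"
    using assms(1) by (simp only: smooth_on_def)
  with assms show ?thesis by simp
qed


section \<open>Smooth functions in adapted coordinates\<close>

lemma openin_polydisc_times_ball:
  assumes "polydisc_times_ball m n W"
  shows "openin (Euclidean_space (2*m+n)) W"
proof -
  obtain c r x\<^sub>0 \<rho> where W: "W = {y \<in> topspace (Euclidean_space (2*m+n)).
      (\<forall>a<m. zcoord a y \<in> ball (c a) (r a)) \<and> (\<Sum>b<n. (xcoord m b y - x\<^sub>0 b)\<^sup>2) < \<rho>\<^sup>2}"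
    using assms unfolding polydisc_times_ball_def by blast
  have "open {y. zcoord a y \<in> ball (c a) (r a)}" for a
  proof -
    have "continuous_on UNIV (zcoord a)"
      unfolding zcoord_def Complex_eq by (intro continuous_intros continuous_on_product_coordinates)
    then show ?thesis
      using open_vimage[OF open_ball] by (simp add: vimage_def)
  qed
  then have "open (\<Inter>a\<in>{..<m}. {y. zcoord a y \<in> ball (c a) (r a)})"
    by (intro open_INT) auto
  moreover have "open {y. (\<Sum>b<n. (xcoord m b y - x\<^sub>0 b)\<^sup>2) < \<rho>\<^sup>2}"
    unfolding xcoord_def
    by (intro open_Collect_less continuous_intros continuous_on_product_coordinates)
  ultimately have "open ((\<Inter>a\<in>{..<m}. {y. zcoord a y \<in> ball (c a) (r a)})
      \<inter> {y. (\<Sum>b<n. (xcoord m b y - x\<^sub>0 b)\<^sup>2) < \<rho>\<^sup>2})"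
    by (rule open_Int)
  then show ?thesis
    unfolding W Euclidean_space_def openin_subtopology euclidean_product_topology[symmetric]
    by (auto simp: euclidean_product_topology)
qed

lemma diffeomorphism_bij_betw:
  assumes "diffeomorphism d M \<A> W U \<phi>" "openin (Euclidean_space d) W" "openin M U"
  shows "bij_betw \<phi> W U"
proof -
  have "topspace (subtopology (Euclidean_space d) W) = W" "topspace (subtopology M U) = U"
    using assms(2,3)[THEN openin_subset] by auto
  moreover have "homeomorphic_map (subtopology (Euclidean_space d) W) (subtopology M U) \<phi>"
    using assms(1) by (simp add: diffeomorphism_def)
  ultimately show ?thesis
    by (metis bij_betw_def homeomorphic_imp_injective_map homeomorphic_imp_surjective_map)
qed

text \<open>
  By the definition of a diffeomorphism, \<open>\<phi>\<close> and its inverse are smooth when read in any chart of the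
  atlas, and this is what compatibility of \<open>inv_into W \<phi>\<close> with that chart asks for; maximality does
  the rest.
\<close>

lemma inverse_diffeomorphism_in_atlas:
  assumes "smooth_manifold d M \<A>" "diffeomorphism d M \<A> W U \<phi>"
    and W: "openin (Euclidean_space d) W" and U: "openin M U"
  shows "(U, inv_into W \<phi>) \<in> \<A>"
proof -
  let ?\<kappa> = "inv_into W \<phi>"
  have bij: "bij_betw \<phi> W U"
    using diffeomorphism_bij_betw[OF assms(2-4)] .
  have inv: "bij_betw ?\<kappa> U W"
    using bij by (rule bij_betw_inv_into)
  have \<kappa>\<phi>: "?\<kappa> (\<phi> y) = y" if "y \<in> W" for y
    using that bij by (rule bij_betw_inv_into_left[rotated])
  have image: "?\<kappa> ` U = W"
    using inv by (rule bij_betw_imp_surj_on)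
  have "chart d M (U, ?\<kappa>)"
  proof -
    have top: "topspace (subtopology (Euclidean_space d) W) = W" "topspace (subtopology M U) = U"
      using W U by (auto dest: openin_subset)
    obtain \<psi> where "homeomorphic_maps (subtopology (Euclidean_space d) W) (subtopology M U) \<phi> \<psi>"
      using assms(2) by (auto simp: diffeomorphism_def homeomorphic_map_maps)
    then have \<psi>: "homeomorphic_map (subtopology M U) (subtopology (Euclidean_space d) W) \<psi>"
      and \<psi>\<phi>: "\<And>y. y \<in> W \<Longrightarrow> \<psi> (\<phi> y) = y"
      unfolding homeomorphic_maps_map top by auto
    have "homeomorphic_map (subtopology M U) (subtopology (Euclidean_space d) W) ?\<kappa>"
    proof (rule homeomorphic_map_eq[OF \<psi>], unfold top)
      fix x assume "x \<in> U"
      then obtain y where "y \<in> W" "x = \<phi> y"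
        using bij by (auto simp: bij_betw_def)
      then show "\<psi> x = ?\<kappa> x" by (simp add: \<psi>\<phi> \<kappa>\<phi>)
    qed
    then show ?thesis
      using W U by (simp add: chart_def image)
  qed
  moreover have "compatible d (U, ?\<kappa>) (V, \<kappa>')" if V: "(V, \<kappa>') \<in> \<A>" for V \<kappa>'
  proof -
    have "openin M V"
      using assms(1) V by (auto simp: smooth_manifold_def chart_def)
    have domain: "{y \<in> W. \<phi> y \<in> V} = ?\<kappa> ` (U \<inter> V)"
    proof -
      have "{y \<in> W. \<phi> y \<in> V} = ?\<kappa> ` \<phi> ` {y \<in> W. \<phi> y \<in> V}"
        by (auto simp: \<kappa>\<phi> image_image)
      also have "\<phi> ` {y \<in> W. \<phi> y \<in> V} = U \<inter> V"
        using bij by (auto simp: bij_betw_def)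
      finally show ?thesis .
    qed
    have "openin (Euclidean_space d) (?\<kappa> ` (U \<inter> V))"
    proof -
      have "openin (subtopology M U) (U \<inter> V)"
        using \<open>openin M V\<close> by (simp add: openin_subtopology_Int2)
      then have "openin (subtopology (Euclidean_space d) W) (?\<kappa> ` (U \<inter> V))"
        using \<open>chart d M (U, ?\<kappa>)\<close> homeomorphic_map_openness_eq
        unfolding chart_def image split by blast
      then show ?thesis
        using W by (simp add: openin_open_subtopology)
    qed
    moreover have "(\<kappa>' \<circ> \<phi>) y = (\<kappa>' \<circ> inv_into U ?\<kappa>) y" if "y \<in> ?\<kappa> ` (U \<inter> V)" for y
    proof -
      have "y \<in> W" using that domain by blast
      then show ?thesis using inv_into_inv_into_eq[OF bij] by simp
    qed
    moreover have "smooth_map_on d (?\<kappa> ` (U \<inter> V)) (\<kappa>' \<circ> \<phi>)"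
      using assms(2) V by (auto simp: diffeomorphism_def domain)
    ultimately have "smooth_map_on d (?\<kappa> ` (U \<inter> V)) (\<kappa>' \<circ> inv_into U ?\<kappa>)"
      unfolding smooth_map_on_def
      by (auto intro: smooth_on_cong[where g = "\<lambda>y. (\<kappa>' \<circ> \<phi>) y _"])
    moreover have "smooth_map_on d (\<kappa>' ` (U \<inter> V)) (?\<kappa> \<circ> inv_into V \<kappa>')"
      using assms(2) V by (auto simp: diffeomorphism_def)
    ultimately show ?thesis
      by (simp add: compatible_def)
  qed
  ultimately show ?thesis
    using assms(1) unfolding smooth_manifold_def by (metis surj_pair)
qed

lemma smooth_function_in_coordinates:
  assumes "smooth_manifold d M \<A>" "diffeomorphism d M \<A> W U \<phi>"
    and "openin (Euclidean_space d) W" "openin M U" "smooth_function d \<A> f"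
  shows "smooth_on d W (\<lambda>y. f (\<phi> y))"
proof -
  let ?\<kappa> = "inv_into W \<phi>"
  have bij: "bij_betw \<phi> W U"
    using diffeomorphism_bij_betw[OF assms(2-4)] .
  then have image: "?\<kappa> ` U = W"
    by (intro bij_betw_imp_surj_on bij_betw_inv_into)
  have "smooth_on d (?\<kappa> ` U) (f \<circ> inv_into U ?\<kappa>)"
    using assms(5) inverse_diffeomorphism_in_atlas[OF assms(1-4)]
    by (auto simp: smooth_function_def)
  then show ?thesis
    unfolding image
    by (rule smooth_on_cong[OF assms(3), rotated]) (simp add: inv_into_inv_into_eq[OF bij])
qed


section \<open>Multiplication of foliated forms by functions\<close>

lemma ext_scale_scale [simp]: "ext_scale c (ext_scale c' \<alpha>) = ext_scale (c * c') \<alpha>"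
  by (simp add: ext_scale_def mult.assoc)

lemma ext_scale_one [simp]: "ext_scale 1 \<alpha> = \<alpha>"
  by (simp add: ext_scale_def)

lemma ext_scale_zero [simp]: "ext_scale c 0 = 0" "ext_scale 0 \<alpha> = 0"
  by (auto simp: ext_scale_def fun_eq_iff)

lemma ext_scale_add: "ext_scale c (\<alpha> + \<beta>) = ext_scale c \<alpha> + ext_scale c \<beta>"
  by (simp add: ext_scale_def fun_eq_iff algebra_simps)

lemma ext_scale_sum: "ext_scale c (sum \<alpha> A) = (\<Sum>a\<in>A. ext_scale c (\<alpha> a))"
  by (rule sum_comp_morphism[symmetric, unfolded o_def, where h = "ext_scale c"])
    (rule ext_scale_zero(1) ext_scale_add)+

lemma wedge_zero_left [simp]: "wedge 0 \<beta> = 0"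
  by (simp add: wedge_def fun_eq_iff)

lemma wedge_add_left: "wedge (\<alpha> + \<alpha>') \<beta> = wedge \<alpha> \<beta> + wedge \<alpha>' \<beta>"
  by (simp add: wedge_def fun_eq_iff algebra_simps sum.distrib)

lemma wedge_add_right: "wedge \<alpha> (\<beta> + \<beta>') = wedge \<alpha> \<beta> + wedge \<alpha> \<beta>'"
  by (simp add: wedge_def fun_eq_iff algebra_simps sum.distrib)

lemma wedge_scale_left: "wedge (ext_scale c \<alpha>) \<beta> = ext_scale c (wedge \<alpha> \<beta>)"
  by (simp add: wedge_def ext_scale_def fun_eq_iff sum_distrib_left algebra_simps)

lemma wedge_scale_right: "wedge \<alpha> (ext_scale c \<beta>) = ext_scale c (wedge \<alpha> \<beta>)"
  by (simp add: wedge_def ext_scale_def fun_eq_iff sum_distrib_left algebra_simps)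

lemma wedge_sum_left: "wedge (sum \<alpha> A) \<beta> = (\<Sum>a\<in>A. wedge (\<alpha> a) \<beta>)"
  by (rule sum_comp_morphism[symmetric, unfolded o_def, where h = "\<lambda>\<alpha>. wedge \<alpha> \<beta>"])
    (rule wedge_zero_left wedge_add_left)+

text \<open>Elements of type \<open>ext\<close> may be nonzero at infinite sets, where every product vanishes; so \<open>ext_one\<close>
  is a unit for the generators but not for all elements.\<close>

lemma wedge_gen_one: "wedge (ext_gen s) ext_one = ext_gen s"
proof
  fix S
  show "wedge (ext_gen s) ext_one S = ext_gen s S"
  proof (cases "finite S")
    case True
    have "wedge (ext_gen s) ext_one S = (\<Sum>T\<in>Pow S. if T = S then ext_gen s S else 0)"
      unfolding wedge_def
    proof (rule sum.cong)
      fix T assume "T \<in> Pow S"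
      show "(-1) ^ card {(t, u). t \<in> T \<and> u \<in> S - T \<and> u < t} * ext_gen s T * ext_one (S - T)
          = (if T = S then ext_gen s S else 0)"
      proof (cases "T = S")
        case False
        with \<open>T \<in> Pow S\<close> have "S - T \<noteq> {}" by blast
        with False show ?thesis by (simp add: ext_one_def)
      qed (simp add: ext_one_def)
    qed simp
    then show ?thesis using True by simp
  next
    case False
    then show ?thesis by (auto simp: wedge_def ext_gen_def)
  qed
qed

lemma pullback_scale: "pullback m \<tau> y (ext_scale c \<alpha>) = ext_scale c (pullback m \<tau> y \<alpha>)"
  by (simp add: pullback_def ext_scale_sum) (simp add: ext_scale_def)

lemma form_mult_add: "form_mult \<phi> c (\<omega> + \<eta>) = form_mult \<phi> c \<omega> + form_mult \<phi> c \<eta>"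
  by (simp add: form_mult_def fun_eq_iff ext_scale_add)

lemma form_mult_form_scale: "form_mult \<phi> c (form_scale a \<omega>) = form_scale a (form_mult \<phi> c \<omega>)"
  by (simp add: form_mult_def form_scale_def mult.commute)

lemma inj_form_mult:
  assumes "\<And>x. c x \<noteq> 0"
  shows "inj (form_mult \<phi> c)"
proof (rule inj_on_inverseI)
  show "form_mult \<phi> (\<lambda>x. inverse (c x)) (form_mult \<phi> c \<omega>) = \<omega>" for \<omega>
    using assms by (simp add: form_mult_def)
qed

text \<open>The compatibility with the coordinate changes survives because a pullback is linear at each
  point and \<open>\<phi> j \<circ> transition W \<phi> i j = \<phi> i\<close> on the overlap.\<close>

lemma form_mult_foliated_forms:
  assumes "\<And>i. i \<in> I \<Longrightarrow> openin (Euclidean_space (2*m+n)) (W i)"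
    and "\<And>i. i \<in> I \<Longrightarrow> smooth_on (2*m+n) (W i) (\<lambda>y. c (\<phi> i y))"
    and \<omega>: "\<omega> \<in> foliated_forms m n I W \<phi> p q"
  shows "form_mult \<phi> c \<omega> \<in> foliated_forms m n I W \<phi> p q"
proof -
  have "form_mult \<phi> c \<omega> i y
      = pullback m (transition W \<phi> i j) y (form_mult \<phi> c \<omega> j (transition W \<phi> i j y))"
    if "i \<in> I" "j \<in> I" "y \<in> overlap W \<phi> i j" for i j y
  proof -
    have "\<phi> j (transition W \<phi> i j y) = \<phi> i y"
      using that(3) by (simp add: transition_def overlap_def f_inv_into_f)
    moreover have "\<omega> i y = pullback m (transition W \<phi> i j) y (\<omega> j (transition W \<phi> i j y))"
      using \<omega> that by (auto simp: foliated_forms_def)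
    ultimately show ?thesis
      by (simp add: form_mult_def pullback_scale)
  qed
  moreover have "smooth_on (2*m+n) (W i) (\<lambda>y. form_mult \<phi> c \<omega> i y S)" if "i \<in> I" for i S
    unfolding form_mult_def ext_scale_def
    using \<omega> that by (intro smooth_on_mult assms) (auto simp: foliated_forms_def)
  moreover have "has_type m p q (form_mult \<phi> c \<omega> i y)" if "i \<in> I" "y \<in> W i" for i y
    using \<omega> that by (auto simp: foliated_forms_def has_type_def form_mult_def ext_scale_def)
  ultimately show ?thesis
    using \<omega> by (auto simp: foliated_forms_def form_mult_def)
qed


section \<open>The Leibniz rule and the comparison of the two differentials\<close>

lemma partial_zbar_mult:
  assumes "smooth_on d W g" "smooth_on d W h" "y \<in> W" "2*a+1 < d"
  shows "partial_zbar a (\<lambda>y. g y * h y) y = g y * partial_zbar a h y + partial_zbar a g y * h y"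
proof -
  have "partial i (\<lambda>y. g y * h y) y = g y * partial i h y + partial i g y * h y"
    if "i < d" for i
    by (intro partial_mult smooth_on_imp_differentiable[OF _ assms(3) that] assms(1,2))
  from this[of "2*a"] this[of "2*a+1"] assms(4) show ?thesis
    by (simp add: partial_zbar_def field_simps)
qed

lemma partial_zbar_inverse_power:
  assumes "smooth_on d W g" "y \<in> W" "g y \<noteq> 0" "2*a+1 < d"
  shows "partial_zbar a (\<lambda>y. inverse (g y) ^ k) y
    = - (of_nat k * inverse (g y) ^ Suc k * partial_zbar a g y)"
proof -
  have "partial i (\<lambda>y. inverse (g y) ^ k) y = - (of_nat k * inverse (g y) ^ Suc k * partial i g y)"
    if "i < d" for i
    by (intro partial_inverse_power smooth_on_imp_differentiable[OF assms(1,2) that] assms(3))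
  moreover have "(- (b * u) + \<i> * - (b * v)) / 2 = - (b * ((u + \<i> * v) / 2))" for b u v
    by (simp add: field_simps)
  ultimately show ?thesis
    using assms(4) by (simp only: partial_zbar_def add_lessD1)
qed

text \<open>The cutoff in \<open>form_of_function\<close> does not affect derivatives at points of the open set \<open>W i\<close>.\<close>

lemma delbar_form_of_function:
  assumes "openin (Euclidean_space (2*m+n)) (W i)" "i \<in> I" "y \<in> W i"
  shows "delbar m I W (form_of_function I W \<phi> c) i y
    = (\<Sum>a<m. ext_scale (partial_zbar a (\<lambda>y. c (\<phi> i y)) y) (dzbar m a))"
proof -
  let ?F = "form_of_function I W \<phi> c"
  have "wedge (dzbar m a) (\<lambda>S. partial_zbar a (\<lambda>y'. ?F i y' S) y)
      = ext_scale (partial_zbar a (\<lambda>y. c (\<phi> i y)) y) (dzbar m a)" if "a < m" for a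
  proof -
    have "partial_zbar a (\<lambda>y'. ?F i y' S) y = partial_zbar a (\<lambda>y. c (\<phi> i y)) y * ext_one S" for S
    proof -
      have "partial j (\<lambda>y'. ?F i y' S) y = partial j (\<lambda>y. c (\<phi> i y) * ext_one S) y"
        if "j < 2*m+n" for j
        by (rule partial_cong[OF assms(1,3) that])
          (use assms(2) in \<open>simp add: form_of_function_def ext_scale_def\<close>)
      from this[of "2*a"] this[of "2*a+1"] \<open>a < m\<close> show ?thesis
        by (cases "S = {}") (simp_all add: partial_zbar_def ext_one_def partial_def)
    qed
    then have "(\<lambda>S. partial_zbar a (\<lambda>y'. ?F i y' S) y)
        = ext_scale (partial_zbar a (\<lambda>y. c (\<phi> i y)) y) ext_one"
      by (simp add: ext_scale_def)
    then show ?thesis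
      by (simp add: wedge_scale_right dzbar_def wedge_gen_one)
  qed
  then show ?thesis
    using assms by (simp add: delbar_def)
qed

lemma delbar_Leibniz:
  assumes "openin (Euclidean_space (2*m+n)) (W i)" "i \<in> I" "y \<in> W i"
    and "smooth_on (2*m+n) (W i) (\<lambda>y. c (\<phi> i y))"
    and "\<And>S. smooth_on (2*m+n) (W i) (\<lambda>y. \<omega> i y S)"
  shows "delbar m I W (form_mult \<phi> c \<omega>) i y = ext_scale (c (\<phi> i y)) (delbar m I W \<omega> i y)
    + wedge (delbar m I W (form_of_function I W \<phi> c) i y) (\<omega> i y)"
proof -
  let ?g = "\<lambda>y. c (\<phi> i y)"
  have "wedge (dzbar m a) (\<lambda>S. partial_zbar a (\<lambda>y'. form_mult \<phi> c \<omega> i y' S) y)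
      = ext_scale (?g y) (wedge (dzbar m a) (\<lambda>S. partial_zbar a (\<lambda>y'. \<omega> i y' S) y))
        + wedge (ext_scale (partial_zbar a ?g y) (dzbar m a)) (\<omega> i y)" if "a < m" for a
  proof -
    have "(\<lambda>S. partial_zbar a (\<lambda>y'. form_mult \<phi> c \<omega> i y' S) y)
        = ext_scale (?g y) (\<lambda>S. partial_zbar a (\<lambda>y'. \<omega> i y' S) y)
          + ext_scale (partial_zbar a ?g y) (\<omega> i y)"
      using partial_zbar_mult[OF assms(4,5,3)] \<open>a < m\<close>
      by (simp add: form_mult_def ext_scale_def fun_eq_iff)
    then show ?thesis
      by (simp add: wedge_add_right wedge_scale_right wedge_scale_left)
  qed
  then show ?thesis
    unfolding delbar_form_of_function[where W = W and \<phi> = \<phi>, OF assms(1-3)] wedge_sum_left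
    using assms(2,3) by (simp add: delbar_def ext_scale_sum sum.distrib)
qed

lemma delbar_inverse_power:
  assumes "openin (Euclidean_space (2*m+n)) (W i)" "i \<in> I" "y \<in> W i"
    and "smooth_on (2*m+n) (W i) (\<lambda>y. f (\<phi> i y))" "f (\<phi> i y) \<noteq> 0"
  shows "delbar m I W (form_of_function I W \<phi> (\<lambda>x. inverse (f x) ^ k)) i y
    = ext_scale (- (of_nat k * inverse (f (\<phi> i y)) ^ Suc k))
        (delbar m I W (form_of_function I W \<phi> f) i y)"
  unfolding delbar_form_of_function[where W = W and \<phi> = \<phi>, OF assms(1-3)] ext_scale_sum
  by (rule sum.cong)
    (simp_all add: partial_zbar_inverse_power[where g = "\<lambda>y. f (\<phi> i y)", OF assms(4,3,5)])

text \<open>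
  The degree of \<open>twisted_delbar \<omega>\<close> is one more than that of \<open>\<omega>\<close>, which accounts for the additional
  factor \<open>1 / f\<close> on the right; it cancels the coefficient \<open>f\<close> in the twisted differential.
\<close>

lemma delbar_eq_twisted_delbar:
  assumes W: "\<And>i. i \<in> I \<Longrightarrow> openin (Euclidean_space (2*m+n)) (W i)"
    and f: "\<And>i. i \<in> I \<Longrightarrow> smooth_on (2*m+n) (W i) (\<lambda>y. f (\<phi> i y))"
    and f_nz: "\<And>i y. i \<in> I \<Longrightarrow> y \<in> W i \<Longrightarrow> f (\<phi> i y) \<noteq> 0"
    and \<omega>: "\<omega> \<in> foliated_forms m n I W \<phi> p q"
  shows "delbar m I W (form_mult \<phi> (\<lambda>x. inverse (f x) ^ (p + q)) \<omega>)
    = form_mult \<phi> (\<lambda>x. inverse (f x) ^ (p + Suc q)) (twisted_delbar m I W \<phi> f p q \<omega>)"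
proof (rule ext, rule ext)
  fix i y
  let ?c = "\<lambda>x. inverse (f x) ^ (p + q)"
  let ?df = "delbar m I W (form_of_function I W \<phi> f) i y"
  show "delbar m I W (form_mult \<phi> ?c \<omega>) i y
    = form_mult \<phi> (\<lambda>x. inverse (f x) ^ (p + Suc q)) (twisted_delbar m I W \<phi> f p q \<omega>) i y"
  proof (cases "i \<in> I \<and> y \<in> W i")
    case True
    then have i: "i \<in> I" and y: "y \<in> W i" by auto
    have nz: "f (\<phi> i y) \<noteq> 0" using f_nz i y .
    have c: "smooth_on (2*m+n) (W i) (\<lambda>y. ?c (\<phi> i y))"
      using f_nz i by (intro smooth_on_power smooth_on_inverse W f) auto
    have "delbar m I W (form_mult \<phi> ?c \<omega>) i y = ext_scale (?c (\<phi> i y)) (delbar m I W \<omega> i y)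
        + wedge (delbar m I W (form_of_function I W \<phi> ?c) i y) (\<omega> i y)"
      using \<omega> i by (intro delbar_Leibniz[where W = W and \<phi> = \<phi> and c = ?c, OF W[OF i] i y c])
        (auto simp: foliated_forms_def)
    also have "\<dots> = ext_scale (?c (\<phi> i y)) (delbar m I W \<omega> i y)
        + ext_scale (- (of_nat (p + q) * inverse (f (\<phi> i y)) ^ Suc (p + q))) (wedge ?df (\<omega> i y))"
      by (simp only: delbar_inverse_power[where W = W and f = f and \<phi> = \<phi>,
            OF W[OF i] i y f[OF i] nz] wedge_scale_left)
    also have "\<dots> = ext_scale (inverse (f (\<phi> i y)) ^ Suc (p + q))
        (ext_scale (f (\<phi> i y)) (delbar m I W \<omega> i y)
          - ext_scale (of_nat (p + q)) (wedge ?df (\<omega> i y)))"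
      using nz by (simp add: ext_scale_def fun_eq_iff field_simps)
    also have "\<dots> = form_mult \<phi> (\<lambda>x. inverse (f x) ^ (p + Suc q)) (twisted_delbar m I W \<phi> f p q \<omega>) i y"
      by (simp add: form_mult_def twisted_delbar_def form_scale_def form_wedge_def)
    finally show ?thesis .
  next
    case False
    then show ?thesis
      by (auto simp: delbar_def form_mult_def twisted_delbar_def form_scale_def form_wedge_def)
  qed
qed


section \<open>Isomorphic complexes have isomorphic cohomology\<close>

text \<open>
  The isomorphism sends a coset to its image under \<open>T q\<close>. As \<open>T q\<close> is injective on all forms, and
  not only on those in \<open>\<Omega> q\<close>, taking images is injective on sets.
\<close>

lemma cohomology_isomorphic:
  fixes T :: "nat \<Rightarrow> 'i form \<Rightarrow> 'i form"
  assumes add: "\<And>q \<omega> \<eta>. T q (\<omega> + \<eta>) = T q \<omega> + T q \<eta>"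
    and scale: "\<And>q a \<omega>. T q (form_scale a \<omega>) = form_scale a (T q \<omega>)"
    and inj: "\<And>q. inj (T q)"
    and onto: "\<And>q. T q ` \<Omega> q = \<Omega>' q"
    and chain: "\<And>q \<omega>. \<omega> \<in> \<Omega> q \<Longrightarrow> D' q (T q \<omega>) = T (Suc q) (D q \<omega>)"
  shows "cohomology \<Omega> D q \<cong>\<^sub>C cohomology \<Omega>' D' q"
proof -
  have zero: "T q 0 = 0" for q
    using add[of q 0 0] by simp
  have zero_iff: "T q \<omega> = 0 \<longleftrightarrow> \<omega> = 0" for q \<omega>
    using inj_eq[OF inj[of q], of \<omega> 0] by (simp add: zero)
  have image_add: "T q ` (X + Y) = T q ` X + T q ` Y" for X Y
    by (force simp: set_plus_def add)
  have B: "T q ` coboundaries \<Omega> D q = coboundaries \<Omega>' D' q"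
  proof (cases q)
    case 0
    then show ?thesis by (simp add: coboundaries_def zero)
  next
    case (Suc k)
    have "T (Suc k) ` D k ` \<Omega> k = D' k ` T k ` \<Omega> k"
      unfolding image_image by (rule image_cong) (auto simp: chain)
    then show ?thesis by (simp add: coboundaries_def Suc onto)
  qed
  have Z: "T q ` cocycles \<Omega> D q = cocycles \<Omega>' D' q"
    unfolding cocycles_def onto[symmetric] by (auto simp: chain zero_iff)
  have coset: "T q ` (\<omega> +o coboundaries \<Omega> D q) = T q \<omega> +o coboundaries \<Omega>' D' q" for \<omega>
    unfolding B[symmetric] by (force simp: elt_set_plus_def add)
  have "bij_betw ((`) (T q)) (vectors (cohomology \<Omega> D q)) (vectors (cohomology \<Omega>' D' q))"
    unfolding bij_betw_def
  proof
    show "inj_on ((`) (T q)) (vectors (cohomology \<Omega> D q))"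
      by (rule inj_onI) (metis inj inj_image_eq_iff)
    show "(`) (T q) ` vectors (cohomology \<Omega> D q) = vectors (cohomology \<Omega>' D' q)"
      by (simp add: cohomology_def image_image coset flip: Z)
  qed
  moreover have "T q ` (form_scale a ` X + coboundaries \<Omega> D q)
      = form_scale a ` T q ` X + coboundaries \<Omega>' D' q" for a X
    by (simp add: image_add B image_image scale)
  ultimately have "linear_iso (cohomology \<Omega> D q) (cohomology \<Omega>' D' q) ((`) (T q))"
    by (simp add: linear_iso_def cohomology_def image_add)
  then show ?thesis
    unfolding isomorphic_spaces_def by blast
qed


section \<open>The isomorphism for a nowhere vanishing function\<close>

theorem corollary2p1:
  fixes m n :: nat
    and M :: "'a topology"
    and \<A> :: "('a set \<times> ('a \<Rightarrow> nat \<Rightarrow> real)) set"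
    and I :: "'i set"
    and W :: "'i \<Rightarrow> (nat \<Rightarrow> real) set"
    and U :: "'i \<Rightarrow> 'a set"
    and \<phi> :: "'i \<Rightarrow> (nat \<Rightarrow> real) \<Rightarrow> 'a"
    and f :: "'a \<Rightarrow> complex"
  assumes "complex_foliation m n M \<A> I W U \<phi>"
    and "smooth_function (2*m+n) \<A> f"
    and "\<forall>x\<in>topspace M. f x \<noteq> 0"
  shows "\<forall>p q. twisted_dolbeault_cohomology m n I W \<phi> f p q \<cong>\<^sub>C dolbeault_cohomology m n I W \<phi> p q"
proof (intro allI)
  fix p q
  let ?\<Omega> = "foliated_forms m n I W \<phi> p"
  have W: "openin (Euclidean_space (2*m+n)) (W i)" if "i \<in> I" for i
    using assms(1) that by (auto simp: complex_foliation_def openin_polydisc_times_ball)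
  have U: "openin M (U i)"
    and \<phi>: "diffeomorphism (2*m+n) M \<A> (W i) (U i) (\<phi> i)" if "i \<in> I" for i
    using assms(1) that by (auto simp: complex_foliation_def)
  have \<phi>_in: "\<phi> i y \<in> topspace M" if "i \<in> I" "y \<in> W i" for i y
    using diffeomorphism_bij_betw[OF \<phi> W U] openin_subset[OF U] that by (auto simp: bij_betw_def)
  have f: "smooth_on (2*m+n) (W i) (\<lambda>y. f (\<phi> i y))" if "i \<in> I" for i
    using assms(1) that
    by (intro smooth_function_in_coordinates[OF _ \<phi> W U assms(2)]) (auto simp: complex_foliation_def)
  \<comment> \<open>The type of the points may be larger than the manifold. With the value 1 outside, multiplication
    by a power of \<open>g\<close> is injective on all forms.\<close>
  define g where "g x = (if x \<in> topspace M then f x else 1)" for x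
  have g_nz: "g x \<noteq> 0" for x
    using assms(3) by (simp add: g_def)
  have g_\<phi>: "g (\<phi> i y) = f (\<phi> i y)" if "i \<in> I" "y \<in> W i" for i y
    using \<phi>_in that by (simp add: g_def)
  have g: "smooth_on (2*m+n) (W i) (\<lambda>y. g (\<phi> i y))" if "i \<in> I" for i
    by (rule smooth_on_cong[OF W[OF that] _ f[OF that]]) (simp add: g_\<phi> that)
  define T where "T q = form_mult \<phi> (\<lambda>x. inverse (g x) ^ (p + q))" for q
  have "T q ` ?\<Omega> q = ?\<Omega> q" for q
  proof
    show "T q ` ?\<Omega> q \<subseteq> ?\<Omega> q"
      unfolding T_def using g_nz
      by (intro image_subsetI form_mult_foliated_forms W smooth_on_power smooth_on_inverse g) auto
    show "?\<Omega> q \<subseteq> T q ` ?\<Omega> q"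
    proof
      fix \<omega> assume "\<omega> \<in> ?\<Omega> q"
      then have "form_mult \<phi> (\<lambda>x. g x ^ (p + q)) \<omega> \<in> ?\<Omega> q"
        by (intro form_mult_foliated_forms W smooth_on_power g)
      moreover have "T q (form_mult \<phi> (\<lambda>x. g x ^ (p + q)) \<omega>) = \<omega>"
        using g_nz by (simp add: T_def form_mult_def flip: power_mult_distrib)
      ultimately show "\<omega> \<in> T q ` ?\<Omega> q" by (metis imageI)
    qed
  qed
  moreover have "delbar m I W (T q \<omega>) = T (Suc q) (twisted_delbar m I W \<phi> f p q \<omega>)"
    if \<omega>: "\<omega> \<in> ?\<Omega> q" for q \<omega>
  proof -
    have inverse_f: "T q \<eta> = form_mult \<phi> (\<lambda>x. inverse (f x) ^ (p + q)) \<eta>"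
      if "\<And>i y. \<not> (i \<in> I \<and> y \<in> W i) \<Longrightarrow> \<eta> i y = 0" for q \<eta>
    proof (rule ext, rule ext)
      show "T q \<eta> i y = form_mult \<phi> (\<lambda>x. inverse (f x) ^ (p + q)) \<eta> i y" for i y
        using that[of i y] g_\<phi>[of i y] by (cases "i \<in> I \<and> y \<in> W i") (auto simp: T_def form_mult_def)
    qed
    have \<omega>_off: "\<omega> i y = 0" if "\<not> (i \<in> I \<and> y \<in> W i)" for i y
      using \<omega> that by (auto simp: foliated_forms_def)
    then have twisted_off: "twisted_delbar m I W \<phi> f p q \<omega> i y = 0"
      if "\<not> (i \<in> I \<and> y \<in> W i)" for i y
      using that
      by (auto simp: twisted_delbar_def delbar_def form_mult_def form_scale_def form_wedge_def)
    have "T q \<omega> = form_mult \<phi> (\<lambda>x. inverse (f x) ^ (p + q)) \<omega>"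
      by (rule inverse_f) (rule \<omega>_off)
    moreover have "T (Suc q) (twisted_delbar m I W \<phi> f p q \<omega>)
        = form_mult \<phi> (\<lambda>x. inverse (f x) ^ (p + Suc q)) (twisted_delbar m I W \<phi> f p q \<omega>)"
      by (rule inverse_f) (rule twisted_off)
    moreover have "delbar m I W (form_mult \<phi> (\<lambda>x. inverse (f x) ^ (p + q)) \<omega>)
        = form_mult \<phi> (\<lambda>x. inverse (f x) ^ (p + Suc q)) (twisted_delbar m I W \<phi> f p q \<omega>)"
      by (rule delbar_eq_twisted_delbar[OF W f _ \<omega>]) (use assms(3) \<phi>_in in auto)
    ultimately show ?thesis by simp
  qed
  moreover have "inj (T q)" for q
    unfolding T_def by (rule inj_form_mult) (simp add: g_nz)
  ultimately show "twisted_dolbeault_cohomology m n I W \<phi> f p q \<cong>\<^sub>C dolbeault_cohomology m n I W \<phi> p q"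
    unfolding twisted_dolbeault_cohomology_def dolbeault_cohomology_def
    by (intro cohomology_isomorphic[where T = T])
      (auto simp: T_def form_mult_add form_mult_form_scale)
qed

end
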